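(* Let $S$ be an inverse semigroup with zero. Then $S$ is isomorphic to $\mathrm{ZM}(\mathcal{C})$ for some left cancellative small category $\mathcal{C}$ if and only if $S$ satisfies the following three conditions: (Z1) $S$ admits unique maximal idempotents; (Z2) the set of paths $P(S)$ (together with $0$) generates $S$ as an inverse semigroup; (Z3) $S$ is right reductive on domain paths.
   Context: Categories. A small category $\mathcal{C}$ (possibly empty) is identified with its set of morphisms; $\mathcal{C}^0$ is the set of objects, each object being identified with its identity morphism; $r,s:\mathcal{C}\to\mathcal{C}^0$ are the range and source maps, and $\alpha\beta$ is defined if and only if $s(\alpha)=r(\beta)$. For $\alpha\in\mathcal{C}$, $\alpha\mathcal{C}=\{\alpha\beta:\beta\in\mathcal{C},\ s(\alpha)=r(\beta)\}$. $\mathcal{C}$ is left cancellative if $\alpha\beta=\alpha\gamma$ (both products defined) implies $\beta=\gamma$. Zigzag inverse semigroup. Let $\mathcal{C}$ be a left cancellative small category. $I(\mathcal{C})$ is the inverse semigroup of all partial bijections of the set $\mathcal{C}$ under composition on the largest possible domain, with $0$ the empty map. For $\alpha\in\mathcal{C}$ let $\tau_\alpha:s(\alpha)\mathcal{C}\to\alpha\mathcal{C}$, $\tau_\alpha(x)=\alpha x$, an element of $I(\mathcal{C})$. A zigzag in $\mathcal{C}$ is a tuple $\zeta=(\alpha_1,\beta_1,\dots,\alpha_n,\beta_n)$ ($n\ge 1$) of elements of $\mathcal{C}$ with $r(\alpha_i)=r(\beta_i)$ for $1\le i\le n$ and $s(\beta_i)=s(\alpha_{i+1})$ for $1\le i\le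 n-1$; its zigzag map is $\phi_\zeta=\tau_{\alpha_1}^{-1}\tau_{\beta_1}\cdots\tau_{\alpha_n}^{-1}\tau_{\beta_n}\in I(\mathcal{C})$. $\mathrm{ZM}(\mathcal{C})$ is the inverse subsemigroup of $I(\mathcal{C})$ consisting of all zigzag maps and the empty map $0$. Inverse semigroups. In an inverse semigroup $S$, $s^*$ denotes the inverse of $s$, and $E(S)$ is the set of idempotents with order $e\le f\iff e=ef$. A maximal idempotent is an idempotent that is maximal among the nonzero idempotents. $S$ admits unique maximal idempotents if for every nonzero idempotent $e$ there is a unique maximal idempotent above $e$. For such $S$, an element $s\in S$ is a path if $s^*s$ is a maximal idempotent; $P(S)$ is the set of paths. For $s\in S$, a path $x$ is a domain path of $s$ if $xx^*\le s^*s$; $P_s$ denotes the set of domain paths of $s$. $S$ is right reductive on domain paths if for all $s,t\in S$: $P_s=P_t$ and $sx=tx$ for all $x\in P_s$ together imply $s=t$. *)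

theory Defs
  imports Main
begin

section \<open>Inverse semigroups with zero\<close>

record 'a zero_semigroup =
  carrier :: "'a set"
  mult :: "'a \<Rightarrow> 'a \<Rightarrow> 'a" (infixl "\<otimes>\<index>" 70)
  zero :: 'a ("\<zero>\<index>")

locale inverse_semigroup_with_zero =
  fixes S :: "'a zero_semigroup" (structure)
  assumes mult_closed: "\<lbrakk>s \<in> carrier S; t \<in> carrier S\<rbrakk> \<Longrightarrow> s \<otimes> t \<in> carrier S"
    and mult_assoc: "\<lbrakk>s \<in> carrier S; t \<in> carrier S; u \<in> carrier S\<rbrakk>
      \<Longrightarrow> (s \<otimes> t) \<otimes> u = s \<otimes> (t \<otimes> u)"
    and ex1_inverse: "s \<in> carrier S
      \<Longrightarrow> \<exists>!t. t \<in> carrier S \<and> s \<otimes> t \<otimes> s = s \<and> t \<otimes> s \<otimes> t = t"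
    and zero_closed: "\<zero> \<in> carrier S"
    and zero_left: "s \<in> carrier S \<Longrightarrow> \<zero> \<otimes> s = \<zero>"
    and zero_right: "s \<in> carrier S \<Longrightarrow> s \<otimes> \<zero> = \<zero>"

definition star :: "'a zero_semigroup \<Rightarrow> 'a \<Rightarrow> 'a" where
  "star S s = (THE t. t \<in> carrier S \<and> s \<otimes>\<^bsub>S\<^esub> t \<otimes>\<^bsub>S\<^esub> s = s \<and> t \<otimes>\<^bsub>S\<^esub> s \<otimes>\<^bsub>S\<^esub> t = t)"

definition idempotents :: "'a zero_semigroup \<Rightarrow> 'a set" where
  "idempotents S = {e \<in> carrier S. e \<otimes>\<^bsub>S\<^esub> e = e}"

text \<open>The order on idempotents; only meaningful when both arguments are idempotents.\<close>

definition idem_le :: "'a zero_semigroup \<Rightarrow> 'a \<Rightarrow> 'a \<Rightarrow> bool" where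
  "idem_le S e f \<longleftrightarrow> e = e \<otimes>\<^bsub>S\<^esub> f"

definition maximal_idempotent :: "'a zero_semigroup \<Rightarrow> 'a \<Rightarrow> bool" where
  "maximal_idempotent S e \<longleftrightarrow> e \<in> idempotents S \<and> e \<noteq> \<zero>\<^bsub>S\<^esub> \<and>
    (\<forall>f \<in> idempotents S. f \<noteq> \<zero>\<^bsub>S\<^esub> \<longrightarrow> idem_le S e f \<longrightarrow> f = e)"

definition admits_unique_maximal_idempotents :: "'a zero_semigroup \<Rightarrow> bool" where
  "admits_unique_maximal_idempotents S \<longleftrightarrow>
    (\<forall>e \<in> idempotents S. e \<noteq> \<zero>\<^bsub>S\<^esub> \<longrightarrow> (\<exists>!m. maximal_idempotent S m \<and> idem_le S e m))"

definition paths :: "'a zero_semigroup \<Rightarrow> 'a set" where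
  "paths S = {s \<in> carrier S. maximal_idempotent S (star S s \<otimes>\<^bsub>S\<^esub> s)}"

definition domain_paths :: "'a zero_semigroup \<Rightarrow> 'a \<Rightarrow> 'a set" where
  "domain_paths S s = {x \<in> paths S. idem_le S (x \<otimes>\<^bsub>S\<^esub> star S x) (star S s \<otimes>\<^bsub>S\<^esub> s)}"

inductive_set generated_inverse_subsemigroup :: "'a zero_semigroup \<Rightarrow> 'a set \<Rightarrow> 'a set"
  for S :: "'a zero_semigroup" and A :: "'a set" where
  base: "a \<in> A \<Longrightarrow> a \<in> generated_inverse_subsemigroup S A"
| mult: "\<lbrakk>a \<in> generated_inverse_subsemigroup S A; b \<in> generated_inverse_subsemigroup S A\<rbrakk>
    \<Longrightarrow> a \<otimes>\<^bsub>S\<^esub> b \<in> generated_inverse_subsemigroup S A"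
| star: "a \<in> generated_inverse_subsemigroup S A
    \<Longrightarrow> star S a \<in> generated_inverse_subsemigroup S A"

definition generated_by_paths :: "'a zero_semigroup \<Rightarrow> bool" where
  "generated_by_paths S \<longleftrightarrow>
    generated_inverse_subsemigroup S (paths S \<union> {\<zero>\<^bsub>S\<^esub>}) = carrier S"

definition right_reductive_on_domain_paths :: "'a zero_semigroup \<Rightarrow> bool" where
  "right_reductive_on_domain_paths S \<longleftrightarrow>
    (\<forall>s \<in> carrier S. \<forall>t \<in> carrier S.
      domain_paths S s = domain_paths S t \<longrightarrow>
      (\<forall>x \<in> domain_paths S s. s \<otimes>\<^bsub>S\<^esub> x = t \<otimes>\<^bsub>S\<^esub> x) \<longrightarrow> s = t)"

text \<open>A multiplicative bijection between inverse semigroups with zero automatically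
  preserves inverses and zero.\<close>

definition isomorphic :: "'a zero_semigroup \<Rightarrow> 'b zero_semigroup \<Rightarrow> bool" (infix "\<simeq>" 50) where
  "S \<simeq> T \<longleftrightarrow> (\<exists>h. bij_betw h (carrier S) (carrier T) \<and>
    (\<forall>s \<in> carrier S. \<forall>t \<in> carrier S. h (s \<otimes>\<^bsub>S\<^esub> t) = h s \<otimes>\<^bsub>T\<^esub> h t))"


section \<open>Left cancellative small categories\<close>

text \<open>A category is presented by its set of morphisms, objects being identified with their
  identity morphisms. The composition function is total in the logic; its value
  at \<open>\<alpha>\<close>, \<open>\<beta>\<close> is only meaningful if \<open>src C \<alpha> = rng C \<beta>\<close>.\<close>

record 'c category =
  Mor :: "'c set"
  Obj :: "'c set"
  src :: "'c \<Rightarrow> 'c"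
  rng :: "'c \<Rightarrow> 'c"
  cat_comp :: "'c \<Rightarrow> 'c \<Rightarrow> 'c" (infixl "\<cdot>\<index>" 70)

locale small_category =
  fixes C :: "'c category" (structure)
  assumes Obj_subset: "Obj C \<subseteq> Mor C"
    and src_Obj: "\<alpha> \<in> Mor C \<Longrightarrow> src C \<alpha> \<in> Obj C"
    and rng_Obj: "\<alpha> \<in> Mor C \<Longrightarrow> rng C \<alpha> \<in> Obj C"
    and src_ident: "v \<in> Obj C \<Longrightarrow> src C v = v"
    and rng_ident: "v \<in> Obj C \<Longrightarrow> rng C v = v"
    and comp_closed: "\<lbrakk>\<alpha> \<in> Mor C; \<beta> \<in> Mor C; src C \<alpha> = rng C \<beta>\<rbrakk> \<Longrightarrow> \<alpha> \<cdot> \<beta> \<in> Mor C"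
    and src_comp: "\<lbrakk>\<alpha> \<in> Mor C; \<beta> \<in> Mor C; src C \<alpha> = rng C \<beta>\<rbrakk> \<Longrightarrow> src C (\<alpha> \<cdot> \<beta>) = src C \<beta>"
    and rng_comp: "\<lbrakk>\<alpha> \<in> Mor C; \<beta> \<in> Mor C; src C \<alpha> = rng C \<beta>\<rbrakk> \<Longrightarrow> rng C (\<alpha> \<cdot> \<beta>) = rng C \<alpha>"
    and comp_assoc: "\<lbrakk>\<alpha> \<in> Mor C; \<beta> \<in> Mor C; \<gamma> \<in> Mor C; src C \<alpha> = rng C \<beta>; src C \<beta> = rng C \<gamma>\<rbrakk>
      \<Longrightarrow> (\<alpha> \<cdot> \<beta>) \<cdot> \<gamma> = \<alpha> \<cdot> (\<beta> \<cdot> \<gamma>)"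
    and ident_left: "\<alpha> \<in> Mor C \<Longrightarrow> rng C \<alpha> \<cdot> \<alpha> = \<alpha>"
    and ident_right: "\<alpha> \<in> Mor C \<Longrightarrow> \<alpha> \<cdot> src C \<alpha> = \<alpha>"

locale left_cancellative_category = small_category C for C :: "'c category" (structure) +
  assumes left_cancel: "\<lbrakk>\<alpha> \<in> Mor C; \<beta> \<in> Mor C; \<gamma> \<in> Mor C; src C \<alpha> = rng C \<beta>; src C \<alpha> = rng C \<gamma>;
      \<alpha> \<cdot> \<beta> = \<alpha> \<cdot> \<gamma>\<rbrakk> \<Longrightarrow> \<beta> = \<gamma>"


section \<open>The zigzag inverse semigroup\<close>

definition symmetric_inverse :: "'c category \<Rightarrow> ('c \<rightharpoonup> 'c) zero_semigroup" where
  "symmetric_inverse C =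
    \<lparr>carrier = {f. dom f \<subseteq> Mor C \<and> ran f \<subseteq> Mor C \<and> inj_on f (dom f)},
     mult = (\<circ>\<^sub>m),
     zero = Map.empty\<rparr>"

text \<open>Only meaningful if \<open>f\<close> is injective on its domain.\<close>

definition partial_inverse :: "('c \<rightharpoonup> 'd) \<Rightarrow> ('d \<rightharpoonup> 'c)" where
  "partial_inverse f = (\<lambda>y. if y \<in> ran f then Some (THE x. f x = Some y) else None)"

definition right_multiples :: "'c category \<Rightarrow> 'c \<Rightarrow> 'c set" where
  "right_multiples C \<alpha> = {\<alpha> \<cdot>\<^bsub>C\<^esub> \<beta> | \<beta>. \<beta> \<in> Mor C \<and> src C \<alpha> = rng C \<beta>}"

definition tau :: "'c category \<Rightarrow> 'c \<Rightarrow> ('c \<rightharpoonup> 'c)" where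
  "tau C \<alpha> = (\<lambda>x. if x \<in> right_multiples C (src C \<alpha>) then Some (\<alpha> \<cdot>\<^bsub>C\<^esub> x) else None)"

text \<open>The zigzag \<open>(\<alpha>\<^sub>1, \<beta>\<^sub>1, \<dots>, \<alpha>\<^sub>n, \<beta>\<^sub>n)\<close> is encoded as the list of pairs
  \<open>[(\<alpha>\<^sub>1, \<beta>\<^sub>1), \<dots>, (\<alpha>\<^sub>n, \<beta>\<^sub>n)]\<close>.\<close>

definition zigzag :: "'c category \<Rightarrow> ('c \<times> 'c) list \<Rightarrow> bool" where
  "zigzag C \<zeta> \<longleftrightarrow> \<zeta> \<noteq> [] \<and>
    (\<forall>(\<alpha>, \<beta>) \<in> set \<zeta>. \<alpha> \<in> Mor C \<and> \<beta> \<in> Mor C \<and> rng C \<alpha> = rng C \<beta>) \<and>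
    (\<forall>i. Suc i < length \<zeta> \<longrightarrow> src C (snd (\<zeta> ! i)) = src C (fst (\<zeta> ! Suc i)))"

text \<open>\<open>Some\<close>, the total identity map, is neutral for \<open>\<circ>\<^sub>m\<close>, so it does not affect
  the value on nonempty lists.\<close>

primrec zigzag_map :: "'c category \<Rightarrow> ('c \<times> 'c) list \<Rightarrow> ('c \<rightharpoonup> 'c)" where
  "zigzag_map C [] = Some"
| "zigzag_map C (p # \<zeta>) =
    partial_inverse (tau C (fst p)) \<circ>\<^sub>m (tau C (snd p) \<circ>\<^sub>m zigzag_map C \<zeta>)"

definition ZM :: "'c category \<Rightarrow> ('c \<rightharpoonup> 'c) zero_semigroup" where
  "ZM C = (symmetric_inverse C)
    \<lparr>carrier := {zigzag_map C \<zeta> | \<zeta>. zigzag C \<zeta>} \<union> {\<zero>\<^bsub>symmetric_inverse C\<^esub>}\<rparr>"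

end

theory Submission imports Defs
begin

text \<open>The idea is that the paths of \<open>ZM C\<close> are a copy of \<open>C\<close>, so that a category with a given zigzag
  semigroup can be read off from the paths of the semigroup.

  Necessity. All zigzag maps commute with right multiplication (\<open>equivariant_zigzag_map\<close>), and the
  domain of each lies in \<open>v C\<close> for one object \<open>v\<close> (\<open>zigzag_map_ends\<close>). Hence the maximal idempotents
  of \<open>ZM C\<close> are the identities \<open>\<tau>\<^sub>v\<close> of the pairwise disjoint sets \<open>v C\<close>
  (\<open>ZM_maximal_idempotent_iff\<close>), and the paths are exactly the maps \<open>\<tau>\<^sub>\<alpha>\<close> (\<open>ZM_paths\<close>). Together
  with the empty map these generate \<open>ZM C\<close> by its very construction. A zigzag map \<open>f\<close> has \<open>\<tau>\<^sub>\<alpha>\<close> as a domain path if and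
  only if \<open>f \<alpha>\<close> is defined, and then \<open>f \<tau>\<^sub>\<alpha>\<close> determines \<open>f \<alpha>\<close>, which is right reductivity. The
  conditions pass from \<open>ZM C\<close> to any isomorphic inverse semigroup.

  Sufficiency. If maximal idempotents are unique, the paths of \<open>S\<close> form a category in which the
  source of \<open>x\<close> is \<open>x\<^sup>\<star> x\<close> and its range is the maximal idempotent above \<open>x x\<^sup>\<star>\<close>; it is left
  cancellative because \<open>x\<^sup>\<star> x y = y\<close> whenever \<open>x y\<close> is a composite
  (\<open>left_cancellative_path_category\<close>). Each \<open>s\<close> acts by left multiplication on its domain
  paths, and this is a homomorphism to partial bijections of the set of paths
  (\<open>path_action_mult\<close>) that sends a path \<open>x\<close> to \<open>\<tau>\<^sub>x\<close> (\<open>path_action_path\<close>). Its injectivity is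
  right reductivity, and since paths generate \<open>S\<close>, its image is generated by the maps \<open>\<tau>\<^sub>x\<close> and
  the empty map, so it is the zigzag semigroup of the category of paths.\<close>

section \<open>Inverse semigroups\<close>

context inverse_semigroup_with_zero
begin

abbreviation inverse ("_\<^sup>\<star>" [1000] 1000)
  where "s\<^sup>\<star> \<equiv> star S s"

declare mult_closed [simp] zero_closed [simp] zero_left [simp] zero_right [simp]

lemma star_inverse:
  assumes "s \<in> carrier S"
  shows "s\<^sup>\<star> \<in> carrier S \<and> s \<otimes> s\<^sup>\<star> \<otimes> s = s \<and> s\<^sup>\<star> \<otimes> s \<otimes> s\<^sup>\<star> = s\<^sup>\<star>"
  unfolding star_def using theI'[OF ex1_inverse[OF assms]] .

lemma star_closed [simp]: "s \<in> carrier S \<Longrightarrow> s\<^sup>\<star> \<in> carrier S"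
  using star_inverse by blast

lemma mult_star_mult [simp]: "s \<in> carrier S \<Longrightarrow> s \<otimes> (s\<^sup>\<star> \<otimes> s) = s"
  using star_inverse[of s] by (simp add: mult_assoc)

lemma star_mult_star [simp]: "s \<in> carrier S \<Longrightarrow> s\<^sup>\<star> \<otimes> (s \<otimes> s\<^sup>\<star>) = s\<^sup>\<star>"
  using star_inverse[of s] by (simp add: mult_assoc)

lemma mult_star_mult_left [simp]:
  "\<lbrakk>s \<in> carrier S; t \<in> carrier S\<rbrakk> \<Longrightarrow> s \<otimes> (s\<^sup>\<star> \<otimes> (s \<otimes> t)) = s \<otimes> t"
  by (metis mult_assoc mult_closed mult_star_mult star_closed)

lemma star_mult_star_left [simp]:
  "\<lbrakk>s \<in> carrier S; t \<in> carrier S\<rbrakk> \<Longrightarrow> s\<^sup>\<star> \<otimes> (s \<otimes> (s\<^sup>\<star> \<otimes> t)) = s\<^sup>\<star> \<otimes> t"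
  by (metis mult_assoc mult_closed star_mult_star star_closed)

lemma star_unique:
  assumes "s \<in> carrier S" "t \<in> carrier S" "s \<otimes> (t \<otimes> s) = s" "t \<otimes> (s \<otimes> t) = t"
  shows "s\<^sup>\<star> = t"
  using ex1_inverse[OF assms(1)] star_inverse[OF assms(1)] assms mult_assoc by metis

lemma star_star [simp]: "s \<in> carrier S \<Longrightarrow> s\<^sup>\<star>\<^sup>\<star> = s"
  by (rule star_unique) auto

lemma idempotentD [dest]:
  assumes "e \<in> idempotents S"
  shows "e \<in> carrier S" "e \<otimes> e = e"
  using assms by (auto simp: idempotents_def)

lemma star_idempotent: "e \<in> idempotents S \<Longrightarrow> e\<^sup>\<star> = e"
  by (rule star_unique) (auto simp: idempotentD)

lemma idempotent_mult_left:
  "\<lbrakk>e \<in> idempotents S; t \<in> carrier S\<rbrakk> \<Longrightarrow> e \<otimes> (e \<otimes> t) = e \<otimes> t"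
  by (metis idempotentD mult_assoc)

text \<open>If \<open>x\<close> is the inverse of \<open>e \<otimes> f\<close>, then so is \<open>f \<otimes> x \<otimes> e\<close>, hence the two are equal; the
  latter is visibly idempotent, and an idempotent is its own inverse.\<close>

lemma idempotent_mult_idempotent:
  assumes e: "e \<in> idempotents S" and f: "f \<in> idempotents S"
  shows "e \<otimes> f \<in> idempotents S"
proof -
  note c [simp] = idempotentD(1)[OF e] idempotentD(1)[OF f]
  note i [simp] = idempotentD(2)[OF e] idempotentD(2)[OF f]
    idempotent_mult_left[OF e] idempotent_mult_left[OF f]
  define x where "x = (e \<otimes> f)\<^sup>\<star>"
  have x [simp]: "x \<in> carrier S" by (simp add: x_def)
  have 1: "e \<otimes> (f \<otimes> (x \<otimes> (e \<otimes> f))) = e \<otimes> f"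
    using mult_star_mult[of "e \<otimes> f"] by (simp add: x_def mult_assoc del: mult_star_mult)
  have 2: "x \<otimes> (e \<otimes> (f \<otimes> x)) = x"
    using star_mult_star[of "e \<otimes> f"] by (simp add: x_def mult_assoc del: star_mult_star)
  have 3: "x \<otimes> (e \<otimes> (f \<otimes> (x \<otimes> t))) = x \<otimes> t" if "t \<in> carrier S" for t
    using arg_cong[OF 2, of "\<lambda>u. u \<otimes> t"] that by (simp add: mult_assoc)
  have "x = f \<otimes> (x \<otimes> e)"
    unfolding x_def
    by (rule star_unique) (simp_all add: mult_assoc 1 3 flip: x_def)
  moreover have "(f \<otimes> (x \<otimes> e)) \<otimes> (f \<otimes> (x \<otimes> e)) = f \<otimes> (x \<otimes> e)"
    by (simp add: mult_assoc 3)
  ultimately have "x \<in> idempotents S"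
    using x by (simp add: idempotents_def)
  moreover have "x\<^sup>\<star> = e \<otimes> f"
    by (simp add: x_def)
  ultimately show ?thesis
    using star_idempotent by metis
qed

lemma idempotents_commute:
  assumes e: "e \<in> idempotents S" and f: "f \<in> idempotents S"
  shows "e \<otimes> f = f \<otimes> e"
proof -
  note c [simp] = idempotentD(1)[OF e] idempotentD(1)[OF f]
  note i [simp] = idempotentD(2)[OF e] idempotentD(2)[OF f]
    idempotent_mult_left[OF e] idempotent_mult_left[OF f]
  have ef: "e \<otimes> f \<in> idempotents S" and fe: "f \<otimes> e \<in> idempotents S"
    using e f idempotent_mult_idempotent by auto
  have "e \<otimes> (f \<otimes> (e \<otimes> f)) = e \<otimes> f" "f \<otimes> (e \<otimes> (f \<otimes> e)) = f \<otimes> e"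
    using idempotentD(2)[OF ef] idempotentD(2)[OF fe] by (simp_all add: mult_assoc)
  then have "(e \<otimes> f)\<^sup>\<star> = f \<otimes> e"
    by (intro star_unique) (simp_all add: mult_assoc)
  then show ?thesis
    using star_idempotent[OF ef] by simp
qed

lemma star_mult_idempotent: "s \<in> carrier S \<Longrightarrow> s\<^sup>\<star> \<otimes> s \<in> idempotents S"
  by (simp add: idempotents_def mult_assoc)

lemma mult_star_idempotent: "s \<in> carrier S \<Longrightarrow> s \<otimes> s\<^sup>\<star> \<in> idempotents S"
  by (simp add: idempotents_def mult_assoc)

text \<open>The commutation of \<open>s\<^sup>\<star> \<otimes> s\<close> and \<open>t \<otimes> t\<^sup>\<star>\<close>, in a form that applies inside products bracketed to
  the right.\<close>

lemma support_commutes: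
  assumes [simp]: "s \<in> carrier S" "t \<in> carrier S" "u \<in> carrier S"
  shows "s\<^sup>\<star> \<otimes> (s \<otimes> (t \<otimes> (t\<^sup>\<star> \<otimes> u))) = t \<otimes> (t\<^sup>\<star> \<otimes> (s\<^sup>\<star> \<otimes> (s \<otimes> u)))"
  using arg_cong[OF idempotents_commute[OF star_mult_idempotent[of s] mult_star_idempotent[of t]],
      of "\<lambda>v. v \<otimes> u"]
  by (simp add: mult_assoc)

lemma star_mult:
  assumes [simp]: "s \<in> carrier S" "t \<in> carrier S"
  shows "(s \<otimes> t)\<^sup>\<star> = t\<^sup>\<star> \<otimes> s\<^sup>\<star>"
proof (rule star_unique)
  show "s \<otimes> t \<otimes> (t\<^sup>\<star> \<otimes> s\<^sup>\<star> \<otimes> (s \<otimes> t)) = s \<otimes> t"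
    using support_commutes[of s t t] by (simp add: mult_assoc)
  show "t\<^sup>\<star> \<otimes> s\<^sup>\<star> \<otimes> (s \<otimes> t \<otimes> (t\<^sup>\<star> \<otimes> s\<^sup>\<star>)) = t\<^sup>\<star> \<otimes> s\<^sup>\<star>"
    using support_commutes[of s t "s\<^sup>\<star>"] by (simp add: mult_assoc)
qed simp_all

text \<open>Once \<open>e\<close> is commuted to the left of \<open>x \<otimes> x\<^sup>\<star>\<close>, the two sides differ by a multiplication by \<open>x\<close> or
  \<open>x\<^sup>\<star>\<close> on the right. This turns conditions on the ranges of paths into equations.\<close>

lemma range_le_iff:
  assumes x [simp]: "x \<in> carrier S" and e: "e \<in> idempotents S"
  shows "idem_le S (x \<otimes> x\<^sup>\<star>) e \<longleftrightarrow> e \<otimes> x = x"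
proof -
  note [simp] = idempotentD(1)[OF e]
  have comm: "x \<otimes> x\<^sup>\<star> \<otimes> e = e \<otimes> (x \<otimes> x\<^sup>\<star>)"
    using idempotents_commute[OF mult_star_idempotent[OF x] e] .
  show ?thesis
  proof
    assume "idem_le S (x \<otimes> x\<^sup>\<star>) e"
    then have "e \<otimes> (x \<otimes> x\<^sup>\<star>) = x \<otimes> x\<^sup>\<star>"
      by (simp add: idem_le_def comm)
    from arg_cong[OF this, of "\<lambda>u. u \<otimes> x"] show "e \<otimes> x = x"
      by (simp add: mult_assoc)
  next
    assume "e \<otimes> x = x"
    from arg_cong[OF this, of "\<lambda>u. u \<otimes> x\<^sup>\<star>"] show "idem_le S (x \<otimes> x\<^sup>\<star>) e"
      by (simp add: idem_le_def comm mult_assoc)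
  qed
qed

lemma domain_paths_iff:
  assumes "s \<in> carrier S"
  shows "x \<in> domain_paths S s \<longleftrightarrow> x \<in> paths S \<and> s\<^sup>\<star> \<otimes> (s \<otimes> x) = x"
  using assms range_le_iff[of x "s\<^sup>\<star> \<otimes> s"]
  by (auto simp: domain_paths_def paths_def star_mult_idempotent mult_assoc)

lemma generated_subset:
  assumes "A \<subseteq> carrier S"
  shows "generated_inverse_subsemigroup S A \<subseteq> carrier S"
proof
  fix a assume "a \<in> generated_inverse_subsemigroup S A"
  then show "a \<in> carrier S"
    by induction (use assms in auto)
qed

end

lemma path_carrier: "x \<in> paths S \<Longrightarrow> x \<in> carrier S"
  by (simp add: paths_def)


section \<open>Invariance under isomorphism\<close>

text \<open>The three conditions only mention products, and idempotents, inverses and zero are determined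
  by the multiplication, so an isomorphism carries them over.\<close>

locale inverse_semigroup_isomorphism =
  S: inverse_semigroup_with_zero S + T: inverse_semigroup_with_zero T
  for S :: "'a zero_semigroup" and T :: "'b zero_semigroup" +
  fixes h :: "'a \<Rightarrow> 'b"
  assumes bij: "bij_betw h (carrier S) (carrier T)"
    and hom: "\<lbrakk>s \<in> carrier S; t \<in> carrier S\<rbrakk> \<Longrightarrow> h (s \<otimes>\<^bsub>S\<^esub> t) = h s \<otimes>\<^bsub>T\<^esub> h t"
begin

lemma image_carrier: "h ` carrier S = carrier T"
  using bij by (simp add: bij_betw_def)

lemma h_closed [simp]: "s \<in> carrier S \<Longrightarrow> h s \<in> carrier T"
  using image_carrier by blast

lemma h_eq_iff [simp]: "\<lbrakk>s \<in> carrier S; t \<in> carrier S\<rbrakk> \<Longrightarrow> h s = h t \<longleftrightarrow> s = t"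
  using bij by (auto simp: bij_betw_def inj_on_def)

lemma h_zero [simp]: "h \<zero>\<^bsub>S\<^esub> = \<zero>\<^bsub>T\<^esub>"
proof -
  obtain z where z: "z \<in> carrier S" "h z = \<zero>\<^bsub>T\<^esub>"
    using image_carrier T.zero_closed by (metis imageE)
  then have "h \<zero>\<^bsub>S\<^esub> = h (z \<otimes>\<^bsub>S\<^esub> \<zero>\<^bsub>S\<^esub>)"
    by simp
  then show ?thesis
    using z hom[of z "\<zero>\<^bsub>S\<^esub>"] by simp
qed

lemma h_star: "s \<in> carrier S \<Longrightarrow> h (star S s) = star T (h s)"
  by (rule T.star_unique[symmetric]) (simp_all flip: hom)

lemma h_idempotent_iff: "s \<in> carrier S \<Longrightarrow> h s \<in> idempotents T \<longleftrightarrow> s \<in> idempotents S"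
  by (simp add: idempotents_def flip: hom)

lemma h_idem_le_iff:
  "\<lbrakk>s \<in> carrier S; t \<in> carrier S\<rbrakk> \<Longrightarrow> idem_le T (h s) (h t) \<longleftrightarrow> idem_le S s t"
  by (simp add: idem_le_def flip: hom)

lemma h_zero_iff: "s \<in> carrier S \<Longrightarrow> h s = \<zero>\<^bsub>T\<^esub> \<longleftrightarrow> s = \<zero>\<^bsub>S\<^esub>"
  using h_eq_iff[of s "\<zero>\<^bsub>S\<^esub>"] by simp

lemma idempotents_image: "idempotents T = h ` idempotents S"
proof -
  have "idempotents T \<subseteq> h ` carrier S"
    by (auto simp: image_carrier)
  then show ?thesis
    using h_idempotent_iff by auto
qed

lemma h_maximal_idempotent_iff:
  assumes "s \<in> carrier S"
  shows "maximal_idempotent T (h s) \<longleftrightarrow> maximal_idempotent S s"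
proof -
  have "(h f \<noteq> \<zero>\<^bsub>T\<^esub> \<longrightarrow> idem_le T (h s) (h f) \<longrightarrow> h f = h s)
      \<longleftrightarrow> (f \<noteq> \<zero>\<^bsub>S\<^esub> \<longrightarrow> idem_le S s f \<longrightarrow> f = s)" if "f \<in> idempotents S" for f
    using S.idempotentD(1)[OF that] assms by (simp add: h_zero_iff h_idem_le_iff)
  then have "(\<forall>f \<in> idempotents T. f \<noteq> \<zero>\<^bsub>T\<^esub> \<longrightarrow> idem_le T (h s) f \<longrightarrow> f = h s)
      \<longleftrightarrow> (\<forall>f \<in> idempotents S. f \<noteq> \<zero>\<^bsub>S\<^esub> \<longrightarrow> idem_le S s f \<longrightarrow> f = s)"
    by (simp add: idempotents_image)
  then show ?thesis
    using assms by (simp add: maximal_idempotent_def h_idempotent_iff h_zero_iff)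
qed

lemma h_path_iff: "s \<in> carrier S \<Longrightarrow> h s \<in> paths T \<longleftrightarrow> s \<in> paths S"
  using h_maximal_idempotent_iff[of "star S s \<otimes>\<^bsub>S\<^esub> s"] by (simp add: paths_def h_star hom)

lemma paths_image: "paths T = h ` paths S"
proof -
  have "paths T \<subseteq> h ` carrier S"
    unfolding image_carrier by (blast dest: path_carrier)
  moreover have "paths S \<subseteq> carrier S"
    by (blast dest: path_carrier)
  ultimately show ?thesis
    using h_path_iff by blast
qed

lemma domain_paths_image:
  assumes "s \<in> carrier S"
  shows "domain_paths T (h s) = h ` domain_paths S s"
proof -
  have "h x \<in> domain_paths T (h s) \<longleftrightarrow> x \<in> domain_paths S s" if "x \<in> carrier S" for x
    using that assms h_idem_le_iff[of "x \<otimes>\<^bsub>S\<^esub> star S x" "star S s \<otimes>\<^bsub>S\<^esub> s"]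
    by (simp add: domain_paths_def h_path_iff h_star hom)
  moreover have "domain_paths T (h s) \<subseteq> h ` carrier S"
    by (auto simp: image_carrier path_carrier domain_paths_def)
  moreover have "domain_paths S s \<subseteq> carrier S"
    by (auto simp: path_carrier domain_paths_def)
  ultimately show ?thesis
    by blast
qed

lemma unique_maximal_idempotents_invariant:
  assumes "admits_unique_maximal_idempotents T"
  shows "admits_unique_maximal_idempotents S"
  unfolding admits_unique_maximal_idempotents_def
proof (intro ballI impI)
  fix e assume e: "e \<in> idempotents S" "e \<noteq> \<zero>\<^bsub>S\<^esub>"
  then have [simp]: "e \<in> carrier S"
    by auto
  have "\<exists>!m. maximal_idempotent T m \<and> idem_le T (h e) m"
    using assms e by (simp add: admits_unique_maximal_idempotents_def h_idempotent_iff h_zero_iff)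
  then obtain m where m: "maximal_idempotent T m" "idem_le T (h e) m"
    and unique: "\<And>m'. maximal_idempotent T m' \<Longrightarrow> idem_le T (h e) m' \<Longrightarrow> m' = m"
    by blast
  have "m \<in> carrier T"
    using m by (auto simp: maximal_idempotent_def)
  then obtain n where n: "n \<in> carrier S" "m = h n"
    using image_carrier by blast
  show "\<exists>!m. maximal_idempotent S m \<and> idem_le S e m"
  proof (rule ex1I[of _ n])
    show "maximal_idempotent S n \<and> idem_le S e n"
      using m n by (simp add: h_maximal_idempotent_iff h_idem_le_iff)
    fix n' assume n': "maximal_idempotent S n' \<and> idem_le S e n'"
    then have "n' \<in> carrier S"
      by (auto simp: maximal_idempotent_def)
    then show "n' = n"
      using n' unique[of "h n'"] n by (simp add: h_maximal_idempotent_iff h_idem_le_iff)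
  qed
qed

lemma generated_by_paths_invariant:
  assumes "generated_by_paths T"
  shows "generated_by_paths S"
proof -
  let ?G = "generated_inverse_subsemigroup S (paths S \<union> {\<zero>\<^bsub>S\<^esub>})"
  have sub: "?G \<subseteq> carrier S"
    by (rule S.generated_subset) (auto simp: path_carrier)
  have "t \<in> h ` ?G" if "t \<in> generated_inverse_subsemigroup T (paths T \<union> {\<zero>\<^bsub>T\<^esub>})" for t
    using that
  proof induction
    case (base a)
    then show ?case
      using paths_image generated_inverse_subsemigroup.base[of _ "paths S \<union> {\<zero>\<^bsub>S\<^esub>}" S]
        h_zero[symmetric] by blast
  next
    case (mult a b)
    then obtain s t where "s \<in> ?G" "t \<in> ?G" "a = h s" "b = h t"
      by blast
    then show ?case
      using sub by (auto simp: subset_iff simp flip: hom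
          intro!: imageI generated_inverse_subsemigroup.mult)
  next
    case (star a)
    then show ?case
      using sub by (auto simp: subset_iff simp flip: h_star
          intro!: imageI generated_inverse_subsemigroup.star)
  qed
  then have "h ` carrier S \<subseteq> h ` ?G"
    using assms by (auto simp: generated_by_paths_def image_carrier)
  then have "carrier S \<subseteq> ?G"
    using h_eq_iff sub by blast
  then show ?thesis
    using sub by (simp add: generated_by_paths_def)
qed

lemma right_reductive_invariant:
  assumes "right_reductive_on_domain_paths T"
  shows "right_reductive_on_domain_paths S"
  unfolding right_reductive_on_domain_paths_def
proof (intro ballI impI)
  fix s t
  assume s: "s \<in> carrier S" and t: "t \<in> carrier S"
    and dom: "domain_paths S s = domain_paths S t"
    and agree: "\<forall>x \<in> domain_paths S s. s \<otimes>\<^bsub>S\<^esub> x = t \<otimes>\<^bsub>S\<^esub> x"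
  have "h s \<otimes>\<^bsub>T\<^esub> h x = h t \<otimes>\<^bsub>T\<^esub> h x" if "x \<in> domain_paths S s" for x
  proof -
    have "x \<in> carrier S"
      using that by (simp add: domain_paths_def path_carrier)
    then show ?thesis
      using s t agree that by (simp flip: hom)
  qed
  then have "h s = h t"
    using assms s t dom
    by (auto simp: right_reductive_on_domain_paths_def domain_paths_image)
  then show "s = t"
    using s t by simp
qed

end


section \<open>Partial bijections\<close>

lemma inj_on_dom_iff:
  "inj_on f (dom f) \<longleftrightarrow> (\<forall>x x' y. f x = Some y \<longrightarrow> f x' = Some y \<longrightarrow> x = x')"
  unfolding inj_on_def dom_def by auto

lemma partial_inverse_eq_Some:
  assumes "inj_on f (dom f)"
  shows "partial_inverse f y = Some x \<longleftrightarrow> f x = Some y"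
proof -
  have "(THE x. f x = Some y) = x" if "f x = Some y" for x
    using that assms by (intro the_equality) (auto simp: inj_on_dom_iff)
  then show ?thesis
    by (auto simp: partial_inverse_def ran_def)
qed

lemma map_eq_iff: "f = g \<longleftrightarrow> (\<forall>x y. f x = Some y \<longleftrightarrow> g x = Some y)"
proof
  assume "\<forall>x y. f x = Some y \<longleftrightarrow> g x = Some y"
  then have "f x = g x" for x
    by (metis not_None_eq)
  then show "f = g" ..
qed simp

lemma inj_partial_inverse: "inj_on f (dom f) \<Longrightarrow> inj_on (partial_inverse f) (dom (partial_inverse f))"
  by (subst inj_on_dom_iff) (simp add: partial_inverse_eq_Some)

lemma inj_map_comp:
  "\<lbrakk>inj_on f (dom f); inj_on g (dom g)\<rbrakk> \<Longrightarrow> inj_on (f \<circ>\<^sub>m g) (dom (f \<circ>\<^sub>m g))"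
  by (fastforce simp: inj_on_dom_iff map_comp_Some_iff)

lemma partial_inverse_map_comp:
  assumes "inj_on f (dom f)" "inj_on g (dom g)"
  shows "partial_inverse (f \<circ>\<^sub>m g) = partial_inverse g \<circ>\<^sub>m partial_inverse f"
  using assms inj_map_comp[OF assms]
  by (auto simp: map_eq_iff partial_inverse_eq_Some map_comp_Some_iff)

lemma partial_inverse_partial_inverse:
  "inj_on f (dom f) \<Longrightarrow> partial_inverse (partial_inverse f) = f"
  by (simp add: map_eq_iff partial_inverse_eq_Some inj_partial_inverse)

lemma map_comp_assoc: "(f \<circ>\<^sub>m g) \<circ>\<^sub>m k = f \<circ>\<^sub>m (g \<circ>\<^sub>m k)"
  by (rule ext) (simp add: map_comp_def split: option.split)

lemma partial_bijection_inverse: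
  assumes "inj_on f (dom f)"
  shows "f \<circ>\<^sub>m partial_inverse f \<circ>\<^sub>m f = f"
    and "partial_inverse f \<circ>\<^sub>m f \<circ>\<^sub>m partial_inverse f = partial_inverse f"
  unfolding map_eq_iff map_comp_Some_iff partial_inverse_eq_Some[OF assms]
  using assms[unfolded inj_on_dom_iff] by blast+

lemma partial_bijection_inverse_unique:
  assumes f: "inj_on f (dom f)" and g: "inj_on g (dom g)"
    and fgf: "f \<circ>\<^sub>m g \<circ>\<^sub>m f = f" and gfg: "g \<circ>\<^sub>m f \<circ>\<^sub>m g = g"
  shows "g = partial_inverse f"
proof -
  have "g y = Some x" if fx: "f x = Some y" for x y
  proof -
    have "(f \<circ>\<^sub>m g \<circ>\<^sub>m f) x = Some y"
      using fgf fx by simp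
    then obtain z where "g y = Some z" "f z = Some y"
      unfolding map_comp_Some_iff using fx by auto
    then show ?thesis
      using fx f by (auto simp: inj_on_dom_iff)
  qed
  moreover have "f x = Some y" if gy: "g y = Some x" for x y
  proof -
    have "(g \<circ>\<^sub>m f \<circ>\<^sub>m g) y = Some x"
      using gfg gy by simp
    then obtain z where "f x = Some z" "g z = Some x"
      unfolding map_comp_Some_iff using gy by auto
    then show ?thesis
      using gy g by (auto simp: inj_on_dom_iff)
  qed
  ultimately have "g y = Some x \<longleftrightarrow> f x = Some y" for x y
    by blast
  then show ?thesis
    by (simp add: map_eq_iff partial_inverse_eq_Some f)
qed


section \<open>The zigzag inverse semigroup of a left cancellative category\<close>

lemma ZM_simps [simp]:
  "mult (ZM C) = (\<circ>\<^sub>m)" "zero (ZM C) = Map.empty"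
  by (simp_all add: ZM_def symmetric_inverse_def)

lemma ZM_carrier_iff:
  "f \<in> carrier (ZM C) \<longleftrightarrow> (\<exists>\<zeta>. zigzag C \<zeta> \<and> f = zigzag_map C \<zeta>) \<or> f = Map.empty"
  by (auto simp: ZM_def symmetric_inverse_def)

lemma zigzag_Cons_iff:
  "zigzag C ((\<alpha>, \<beta>) # \<zeta>) \<longleftrightarrow> \<alpha> \<in> Mor C \<and> \<beta> \<in> Mor C \<and> rng C \<alpha> = rng C \<beta> \<and>
    (\<zeta> = [] \<or> src C \<beta> = src C (fst (hd \<zeta>)) \<and> zigzag C \<zeta>)"
  by (cases \<zeta>) (auto simp: zigzag_def nth_Cons split: nat.splits)

lemma zigzag_nonempty: "zigzag C \<zeta> \<Longrightarrow> \<zeta> \<noteq> []"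
  by (simp add: zigzag_def)

lemma zigzag_induct [consumes 1, case_names single Cons]:
  assumes "zigzag C \<zeta>"
    and "\<And>\<alpha> \<beta>. \<lbrakk>\<alpha> \<in> Mor C; \<beta> \<in> Mor C; rng C \<alpha> = rng C \<beta>\<rbrakk> \<Longrightarrow> P [(\<alpha>, \<beta>)]"
    and "\<And>\<alpha> \<beta> \<zeta>. \<lbrakk>\<alpha> \<in> Mor C; \<beta> \<in> Mor C; rng C \<alpha> = rng C \<beta>; zigzag C \<zeta>;
      src C \<beta> = src C (fst (hd \<zeta>)); P \<zeta>\<rbrakk> \<Longrightarrow> P ((\<alpha>, \<beta>) # \<zeta>)"
  shows "P \<zeta>"
  using assms(1)
proof (induction \<zeta>)
  case Nil
  then show ?case
    by (simp add: zigzag_def)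
next
  case (Cons p \<zeta>)
  then show ?case
    using assms(2,3) by (cases p) (auto simp: zigzag_Cons_iff)
qed

lemma zigzag_append:
  assumes "zigzag C \<zeta>" "zigzag C \<eta>" "src C (snd (last \<zeta>)) = src C (fst (hd \<eta>))"
  shows "zigzag C (\<zeta> @ \<eta>)"
  using assms
  by (induction rule: zigzag_induct) (auto simp: zigzag_Cons_iff zigzag_nonempty)

lemma zigzag_map_single:
  "zigzag_map C [(\<alpha>, \<beta>)] = partial_inverse (tau C \<alpha>) \<circ>\<^sub>m tau C \<beta>"
proof -
  have "tau C \<beta> \<circ>\<^sub>m Some = tau C \<beta>"
    by (rule ext) (simp add: map_comp_def)
  then show ?thesis
    by simp
qed

lemma zigzag_map_append: "zigzag_map C (\<zeta> @ \<eta>) = zigzag_map C \<zeta> \<circ>\<^sub>m zigzag_map C \<eta>"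
proof (induction \<zeta>)
  case Nil
  show ?case
    by (rule ext) (simp add: map_comp_def split: option.split)
qed (simp add: map_comp_assoc)

text \<open>Every \<open>\<tau>\<^sub>\<alpha>\<close> commutes with right multiplication, and this passes to inverses and composites.
  A partial bijection of this kind has a right ideal as its domain, and is determined on \<open>v C\<close>, for
  an object \<open>v\<close> in its domain, by its value at \<open>v\<close>.\<close>

definition equivariant :: "'c category \<Rightarrow> ('c \<rightharpoonup> 'c) \<Rightarrow> bool" where
  "equivariant C f \<longleftrightarrow> inj_on f (dom f) \<and>
    (\<forall>x y. f x = Some y \<longrightarrow> x \<in> Mor C \<and> y \<in> Mor C \<and> src C y = src C x \<and>
      (\<forall>z \<in> Mor C. rng C z = src C x \<longrightarrow> f (x \<cdot>\<^bsub>C\<^esub> z) = Some (y \<cdot>\<^bsub>C\<^esub> z)))"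

lemma equivariant_inj: "equivariant C f \<Longrightarrow> inj_on f (dom f)"
  by (simp add: equivariant_def)

lemma equivariantD:
  assumes "equivariant C f" "f x = Some y"
  shows "x \<in> Mor C" "y \<in> Mor C" "src C y = src C x"
    and "\<lbrakk>z \<in> Mor C; rng C z = src C x\<rbrakk> \<Longrightarrow> f (x \<cdot>\<^bsub>C\<^esub> z) = Some (y \<cdot>\<^bsub>C\<^esub> z)"
  using assms unfolding equivariant_def by blast+

lemma equivariant_empty: "equivariant C Map.empty"
  by (simp add: equivariant_def)

lemma equivariant_partial_inverse: "equivariant C f \<Longrightarrow> equivariant C (partial_inverse f)"
  using equivariantD[of C f] equivariant_inj[of C f]
  by (auto simp: equivariant_def[of C "partial_inverse f"] inj_partial_inverse partial_inverse_eq_Some)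

lemma equivariant_map_comp:
  assumes "equivariant C f" "equivariant C g"
  shows "equivariant C (f \<circ>\<^sub>m g)"
  unfolding equivariant_def
proof (intro conjI allI impI ballI)
  show "inj_on (f \<circ>\<^sub>m g) (dom (f \<circ>\<^sub>m g))"
    using assms equivariant_inj inj_map_comp by blast
next
  fix x y assume "(f \<circ>\<^sub>m g) x = Some y"
  then obtain u where u: "g x = Some u" "f u = Some y"
    by (auto simp: map_comp_Some_iff)
  note g = equivariantD[OF assms(2) u(1)] and f = equivariantD[OF assms(1) u(2)]
  show "x \<in> Mor C" "y \<in> Mor C" "src C y = src C x"
    using f g by simp_all
  fix z assume "z \<in> Mor C" "rng C z = src C x"
  then show "(f \<circ>\<^sub>m g) (x \<cdot>\<^bsub>C\<^esub> z) = Some (y \<cdot>\<^bsub>C\<^esub> z)"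
    using f g by (simp add: map_comp_Some_iff)
qed

context left_cancellative_category
begin

lemma tau_eq_Some:
  assumes "\<alpha> \<in> Mor C"
  shows "tau C \<alpha> x = Some y \<longleftrightarrow> x \<in> Mor C \<and> rng C x = src C \<alpha> \<and> y = \<alpha> \<cdot> x"
proof -
  have "right_multiples C (src C \<alpha>) = {x \<in> Mor C. rng C x = src C \<alpha>}"
    using assms src_Obj[OF assms]
    by (auto simp: right_multiples_def src_ident) (metis ident_left)+
  then show ?thesis
    by (auto simp: tau_def)
qed

lemma equivariant_tau: "\<alpha> \<in> Mor C \<Longrightarrow> equivariant C (tau C \<alpha>)"
  unfolding equivariant_def inj_on_dom_iff
  by (auto simp: tau_eq_Some comp_closed src_comp rng_comp comp_assoc intro: left_cancel)

lemmas inj_tau = equivariant_inj[OF equivariant_tau]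

lemma equivariant_zigzag_map: "zigzag C \<zeta> \<Longrightarrow> equivariant C (zigzag_map C \<zeta>)"
proof (induction rule: zigzag_induct)
  case (single \<alpha> \<beta>)
  then show ?case
    unfolding zigzag_map_single
    by (simp add: equivariant_tau equivariant_map_comp equivariant_partial_inverse)
qed (simp add: equivariant_tau equivariant_map_comp equivariant_partial_inverse)

lemma partial_inverse_tau_eq_Some:
  "\<alpha> \<in> Mor C \<Longrightarrow> partial_inverse (tau C \<alpha>) y = Some x \<longleftrightarrow> x \<in> Mor C \<and> rng C x = src C \<alpha> \<and> y = \<alpha> \<cdot> x"
  by (simp add: partial_inverse_eq_Some inj_tau tau_eq_Some)

text \<open>The domain of a zigzag map lies in one set \<open>v C\<close>, and so does its range. These sets are disjoint
  for distinct objects, so two zigzags that do not match have product zero.\<close>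

lemma zigzag_map_ends:
  assumes "zigzag C \<zeta>" "zigzag_map C \<zeta> x = Some y"
  shows "rng C x = src C (snd (last \<zeta>)) \<and> rng C y = src C (fst (hd \<zeta>))"
  using assms
  by (induction arbitrary: y rule: zigzag_induct)
    (auto simp: map_comp_Some_iff tau_eq_Some partial_inverse_tau_eq_Some zigzag_nonempty)

lemma ZM_equivariant: "f \<in> carrier (ZM C) \<Longrightarrow> equivariant C f"
  by (auto simp: ZM_carrier_iff equivariant_zigzag_map equivariant_empty)

lemmas ZM_inj = equivariant_inj[OF ZM_equivariant]

lemma ZM_empty: "Map.empty \<in> carrier (ZM C)"
  by (simp add: ZM_carrier_iff)

lemma ZM_mult_closed:
  assumes "f \<in> carrier (ZM C)" "g \<in> carrier (ZM C)"
  shows "f \<circ>\<^sub>m g \<in> carrier (ZM C)"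
proof (cases "f \<circ>\<^sub>m g = Map.empty")
  case False
  then obtain x y z where xyz: "g x = Some y" "f y = Some z"
    by (auto simp: fun_eq_iff map_comp_Some_iff)
  then obtain \<zeta> \<eta> where \<zeta>: "zigzag C \<zeta>" "f = zigzag_map C \<zeta>" and \<eta>: "zigzag C \<eta>" "g = zigzag_map C \<eta>"
    using assms by (auto simp: ZM_carrier_iff)
  then have "src C (snd (last \<zeta>)) = src C (fst (hd \<eta>))"
    using xyz zigzag_map_ends by metis
  then have "zigzag C (\<zeta> @ \<eta>)"
    using \<zeta> \<eta> by (simp add: zigzag_append)
  then show ?thesis
    using \<zeta> \<eta> zigzag_map_append by (metis ZM_carrier_iff)
qed (simp add: ZM_empty)

text \<open>The map \<open>\<tau>\<^sub>\<alpha>\<close> comes from the zigzag \<open>(r(\<alpha>), \<alpha>)\<close>.\<close>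

lemma tau_in_ZM: "\<alpha> \<in> Mor C \<Longrightarrow> tau C \<alpha> \<in> carrier (ZM C)"
proof -
  assume \<alpha>: "\<alpha> \<in> Mor C"
  then have r: "rng C \<alpha> \<in> Mor C" "src C (rng C \<alpha>) = rng C \<alpha>" "rng C (rng C \<alpha>) = rng C \<alpha>"
    using rng_Obj Obj_subset src_ident rng_ident by auto
  have "zigzag_map C [(rng C \<alpha>, \<alpha>)] = tau C \<alpha>"
    unfolding zigzag_map_single map_eq_iff
    using \<alpha> r
    by (auto simp: map_comp_Some_iff tau_eq_Some partial_inverse_tau_eq_Some rng_comp comp_closed)
      (metis comp_closed ident_left rng_comp)+
  moreover have "zigzag C [(rng C \<alpha>, \<alpha>)]"
    using \<alpha> r by (simp add: zigzag_Cons_iff)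
  ultimately show ?thesis
    by (metis ZM_carrier_iff)
qed

lemma ZM_partial_inverse_closed:
  assumes "f \<in> carrier (ZM C)"
  shows "partial_inverse f \<in> carrier (ZM C)"
proof -
  \<comment> \<open>The inverse of a zigzag map belongs to the zigzag read backwards. Reversal is carried out one
    pair at a time, the other pairs being absorbed by closure under products.\<close>
  have single_inverse: "partial_inverse (zigzag_map C [(\<alpha>, \<beta>)]) = zigzag_map C [(\<beta>, \<alpha>)]"
    and single_in_ZM: "zigzag_map C [(\<beta>, \<alpha>)] \<in> carrier (ZM C)"
    and single_inj: "inj_on (zigzag_map C [(\<alpha>, \<beta>)]) (dom (zigzag_map C [(\<alpha>, \<beta>)]))"
    if "\<alpha> \<in> Mor C" "\<beta> \<in> Mor C" "rng C \<alpha> = rng C \<beta>" for \<alpha> \<beta>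
  proof -
    have "zigzag C [(\<alpha>, \<beta>)]" "zigzag C [(\<beta>, \<alpha>)]"
      using that by (simp_all add: zigzag_Cons_iff)
    then show "zigzag_map C [(\<beta>, \<alpha>)] \<in> carrier (ZM C)"
      and "inj_on (zigzag_map C [(\<alpha>, \<beta>)]) (dom (zigzag_map C [(\<alpha>, \<beta>)]))"
      using ZM_carrier_iff equivariant_inj[OF equivariant_zigzag_map] by blast+
    show "partial_inverse (zigzag_map C [(\<alpha>, \<beta>)]) = zigzag_map C [(\<beta>, \<alpha>)]"
      unfolding zigzag_map_single using that
      by (simp add: partial_inverse_map_comp partial_inverse_partial_inverse inj_partial_inverse
          inj_tau)
  qed
  have "partial_inverse (zigzag_map C \<zeta>) \<in> carrier (ZM C)" if "zigzag C \<zeta>" for \<zeta>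
    using that
  proof (induction rule: zigzag_induct)
    case (single \<alpha> \<beta>)
    then show ?case
      by (simp only: single_inverse single_in_ZM)
  next
    case (Cons \<alpha> \<beta> \<zeta>)
    have "partial_inverse (zigzag_map C ([(\<alpha>, \<beta>)] @ \<zeta>))
        = partial_inverse (zigzag_map C \<zeta>) \<circ>\<^sub>m zigzag_map C [(\<beta>, \<alpha>)]"
      unfolding zigzag_map_append
      using Cons
      by (simp only: partial_inverse_map_comp single_inj single_inverse
          equivariant_inj[OF equivariant_zigzag_map])
    then show ?case
      using Cons ZM_mult_closed single_in_ZM by simp
  qed
  moreover have "partial_inverse (Map.empty :: 'c \<rightharpoonup> 'c) = Map.empty"
    by (simp add: partial_inverse_def)
  ultimately show ?thesis
    using assms by (auto simp: ZM_carrier_iff[of f] ZM_empty)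
qed

text \<open>Inverses are unique because they already are among all partial bijections.\<close>

lemma ZM_inverse_semigroup: "inverse_semigroup_with_zero (ZM C)"
proof
  fix s assume s: "s \<in> carrier (ZM C)"
  show "\<exists>!t. t \<in> carrier (ZM C) \<and> s \<otimes>\<^bsub>ZM C\<^esub> t \<otimes>\<^bsub>ZM C\<^esub> s = s \<and> t \<otimes>\<^bsub>ZM C\<^esub> s \<otimes>\<^bsub>ZM C\<^esub> t = t"
    using s ZM_partial_inverse_closed partial_bijection_inverse[OF ZM_inj]
      partial_bijection_inverse_unique[OF ZM_inj ZM_inj]
    by (intro ex1I[of _ "partial_inverse s"]) auto
qed (simp_all add: ZM_mult_closed ZM_empty map_comp_assoc)

sublocale ZM: inverse_semigroup_with_zero "ZM C"
  by (rule ZM_inverse_semigroup)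

lemma ZM_star: "f \<in> carrier (ZM C) \<Longrightarrow> star (ZM C) f = partial_inverse f"
  using partial_bijection_inverse[OF ZM_inj, of f]
  by (intro ZM.star_unique) (simp_all add: ZM_partial_inverse_closed map_comp_assoc)

lemma ZM_idempotent_iff:
  assumes "f \<in> carrier (ZM C)"
  shows "f \<in> idempotents (ZM C) \<longleftrightarrow> (\<forall>x y. f x = Some y \<longrightarrow> y = x)"
proof
  assume "f \<in> idempotents (ZM C)"
  then have "f \<circ>\<^sub>m f = f"
    by (simp add: idempotents_def)
  have "y = x" if "f x = Some y" for x y
  proof -
    have "(f \<circ>\<^sub>m f) x = Some y"
      using \<open>f \<circ>\<^sub>m f = f\<close> that by simp
    then have "f y = Some y"
      using that by (simp add: map_comp_Some_iff)
    then show ?thesis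
      using that ZM_inj[OF assms] unfolding inj_on_dom_iff by blast
  qed
  then show "\<forall>x y. f x = Some y \<longrightarrow> y = x"
    by blast
next
  assume *: "\<forall>x y. f x = Some y \<longrightarrow> y = x"
  then have "f \<circ>\<^sub>m f = f"
    unfolding map_eq_iff map_comp_Some_iff by blast
  then show "f \<in> idempotents (ZM C)"
    using assms by (simp add: idempotents_def)
qed

lemma tau_object:
  "v \<in> Obj C \<Longrightarrow> tau C v x = Some y \<longleftrightarrow> x \<in> Mor C \<and> rng C x = v \<and> y = x"
  using Obj_subset ident_left[of x] by (auto simp: tau_eq_Some src_ident)

lemma tau_object_idempotent: "v \<in> Obj C \<Longrightarrow> tau C v \<in> idempotents (ZM C)"
  using Obj_subset by (auto simp: ZM_idempotent_iff tau_in_ZM tau_object)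

lemma tau_object_nonzero: "v \<in> Obj C \<Longrightarrow> tau C v \<noteq> Map.empty"
  using tau_object[of v v v] Obj_subset by (auto simp: rng_ident)

lemma idem_le_tau_object_iff:
  assumes e: "e \<in> idempotents (ZM C)" and v: "v \<in> Obj C"
  shows "idem_le (ZM C) e (tau C v) \<longleftrightarrow> (\<forall>x \<in> dom e. rng C x = v)"
proof -
  have ec: "e \<in> carrier (ZM C)"
    using e by (rule ZM.idempotentD)
  show ?thesis
    using equivariantD(1)[OF ZM_equivariant[OF ec]] v
    by (auto simp: idem_le_def map_eq_iff map_comp_Some_iff tau_object dom_def)
qed

text \<open>The domain of a nonzero zigzag map is nonempty and lies in \<open>v C\<close> for a single object \<open>v\<close>, the
  common range of its elements.\<close>

lemma idempotent_below_tau_object: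
  assumes e: "e \<in> idempotents (ZM C)" and nz: "e \<noteq> Map.empty"
  shows "\<exists>!v. v \<in> Obj C \<and> idem_le (ZM C) e (tau C v)"
proof -
  have ec: "e \<in> carrier (ZM C)"
    using e by (rule ZM.idempotentD)
  then obtain \<zeta> where \<zeta>: "zigzag C \<zeta>" "e = zigzag_map C \<zeta>"
    using nz by (auto simp: ZM_carrier_iff)
  obtain x y where x: "e x = Some y"
    using nz by (metis not_None_eq ext)
  have "rng C x \<in> Obj C"
    using equivariantD(1)[OF ZM_equivariant[OF ec] x] rng_Obj by blast
  moreover have "rng C x' = rng C x" if "x' \<in> dom e" for x'
    using that x \<zeta> zigzag_map_ends by fastforce
  moreover have "x \<in> dom e"
    using x by blast
  ultimately show ?thesis
    using idem_le_tau_object_iff[OF e] by (intro ex1I[of _ "rng C x"]) (blast, metis)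
qed

text \<open>A nonzero idempotent above \<open>\<tau>\<^sub>v\<close> is defined at \<open>v\<close>, so the only \<open>\<tau>\<^sub>w\<close> that can lie above it is
  \<open>\<tau>\<^sub>v\<close> itself.\<close>

lemma ZM_maximal_idempotent_iff:
  "maximal_idempotent (ZM C) e \<longleftrightarrow> (\<exists>v \<in> Obj C. e = tau C v)"
proof
  assume "maximal_idempotent (ZM C) e"
  then have e: "e \<in> idempotents (ZM C)" "e \<noteq> Map.empty"
    and max: "\<And>f. f \<in> idempotents (ZM C) \<Longrightarrow> f \<noteq> Map.empty \<Longrightarrow> idem_le (ZM C) e f \<Longrightarrow> f = e"
    by (auto simp: maximal_idempotent_def)
  then show "\<exists>v \<in> Obj C. e = tau C v"
    using idempotent_below_tau_object[OF e] max tau_object_idempotent tau_object_nonzero by metis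
next
  assume "\<exists>v \<in> Obj C. e = tau C v"
  then obtain v where v: "v \<in> Obj C" and e: "e = tau C v" by blast
  have "f = e" if f: "f \<in> idempotents (ZM C)" "f \<noteq> Map.empty" and le: "idem_le (ZM C) e f" for f
  proof -
    obtain w where w: "w \<in> Obj C" and fw: "idem_le (ZM C) f (tau C w)"
      using idempotent_below_tau_object[OF f] by blast
    have ef: "e \<circ>\<^sub>m f = e" and fc: "f \<in> carrier (ZM C)"
      using le f by (auto simp: idem_le_def)
    have "e v = Some v"
      using v e Obj_subset by (auto simp: tau_object rng_ident)
    then have "v \<in> dom f"
      using ef by (metis domI map_comp_Some_iff)
    then have "w = v"
      using fw idem_le_tau_object_iff[OF f(1) w] rng_ident[OF v] by simp
    then have "f = f \<circ>\<^sub>m e"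
      using fw e by (simp add: idem_le_def)
    also have "\<dots> = e \<circ>\<^sub>m f"
      using ZM.idempotents_commute[OF f(1) tau_object_idempotent[OF v]] e by simp
    finally show ?thesis
      using ef by simp
  qed
  then show "maximal_idempotent (ZM C) e"
    using v e tau_object_idempotent tau_object_nonzero by (auto simp: maximal_idempotent_def)
qed

text \<open>A path of \<open>ZM C\<close> is a zigzag map \<open>f\<close> with domain \<open>v C\<close>; equivariance gives
  \<open>f x = f (v \<cdot> x) = f v \<cdot> x\<close>, so \<open>f\<close> is \<open>\<tau>\<^sub>\<alpha>\<close> for \<open>\<alpha> = f v\<close>.\<close>

lemma ZM_paths: "paths (ZM C) = tau C ` Mor C"
proof (intro equalityI subsetI)
  fix f assume "f \<in> paths (ZM C)"
  then obtain v where f: "f \<in> carrier (ZM C)" and v: "v \<in> Obj C"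
    and dom: "partial_inverse f \<circ>\<^sub>m f = tau C v"
    by (auto simp: paths_def ZM_maximal_idempotent_iff ZM_star)
  note eq = equivariantD[OF ZM_equivariant[OF f]]
  have dom_f: "x \<in> dom f \<longleftrightarrow> x \<in> Mor C \<and> rng C x = v" for x
  proof -
    have "x \<in> dom f \<longleftrightarrow> (partial_inverse f \<circ>\<^sub>m f) x = Some x"
      unfolding map_comp_Some_iff partial_inverse_eq_Some[OF ZM_inj[OF f]] by blast
    then show ?thesis
      using v by (simp add: dom tau_object)
  qed
  have "v \<in> dom f"
    using dom_f v Obj_subset rng_ident by blast
  then obtain \<alpha> where \<alpha>: "f v = Some \<alpha>"
    by blast
  have \<alpha>C: "\<alpha> \<in> Mor C" "src C \<alpha> = v"
    using eq(2,3)[OF \<alpha>] v by (simp_all add: src_ident)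
  have "f x = Some (\<alpha> \<cdot> x)" if "x \<in> Mor C" "rng C x = v" for x
    using eq(4)[OF \<alpha>, of x] ident_left[of x] that v by (simp add: src_ident)
  then have "f x = Some y \<longleftrightarrow> tau C \<alpha> x = Some y" for x y
    using dom_f[of x] \<alpha>C by (auto simp: tau_eq_Some)
  then have "f = tau C \<alpha>"
    by (simp add: map_eq_iff)
  then show "f \<in> tau C ` Mor C"
    using \<alpha>C by blast
next
  fix f assume "f \<in> tau C ` Mor C"
  then obtain \<alpha> where \<alpha>: "\<alpha> \<in> Mor C" "f = tau C \<alpha>"
    by blast
  have "partial_inverse f \<circ>\<^sub>m f = tau C (src C \<alpha>)"
    unfolding \<alpha>(2) map_eq_iff map_comp_Some_iff
      partial_inverse_tau_eq_Some[OF \<alpha>(1)] tau_object[OF src_Obj[OF \<alpha>(1)]] tau_eq_Some[OF \<alpha>(1)]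
    using left_cancel \<alpha>(1) by metis
  then show "f \<in> paths (ZM C)"
    using \<alpha> src_Obj by (auto simp: paths_def ZM_maximal_idempotent_iff ZM_star tau_in_ZM)
qed

text \<open>The range of \<open>\<tau>\<^sub>\<alpha>\<close> is \<open>\<alpha> C\<close>, and the domain of \<open>f\<close>, being a right ideal, contains \<open>\<alpha> C\<close> as soon
  as it contains \<open>\<alpha>\<close>.\<close>

lemma ZM_domain_path_iff:
  assumes f: "f \<in> carrier (ZM C)" and \<alpha>: "\<alpha> \<in> Mor C"
  shows "tau C \<alpha> \<in> domain_paths (ZM C) f \<longleftrightarrow> \<alpha> \<in> dom f"
proof -
  note eq = equivariantD[OF ZM_equivariant[OF f]]
  have s: "src C \<alpha> \<in> Mor C" "rng C (src C \<alpha>) = src C \<alpha>" "\<alpha> \<cdot> src C \<alpha> = \<alpha>"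
    using \<alpha> src_Obj Obj_subset rng_ident ident_right by auto
  have support: "(partial_inverse f \<circ>\<^sub>m f) x = Some y \<longleftrightarrow> x \<in> dom f \<and> y = x" for x y
    using ZM_inj[OF f] by (auto simp: map_comp_Some_iff partial_inverse_eq_Some inj_on_dom_iff)
  have "tau C \<alpha> \<in> domain_paths (ZM C) f \<longleftrightarrow> (partial_inverse f \<circ>\<^sub>m f) \<circ>\<^sub>m tau C \<alpha> = tau C \<alpha>"
    using f \<alpha> by (simp add: ZM.domain_paths_iff ZM_paths ZM_star map_comp_assoc)
  also have "\<dots> \<longleftrightarrow> (\<forall>x \<in> Mor C. rng C x = src C \<alpha> \<longrightarrow> \<alpha> \<cdot> x \<in> dom f)"
    using \<alpha> by (auto simp: map_eq_iff map_comp_Some_iff[of "partial_inverse f \<circ>\<^sub>m f"] support tau_eq_Some)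
  also have "\<dots> \<longleftrightarrow> \<alpha> \<in> dom f"
    using s eq(4) by (metis domD domI)
  finally show ?thesis .
qed

lemma ZM_admits_unique_maximal_idempotents: "admits_unique_maximal_idempotents (ZM C)"
  unfolding admits_unique_maximal_idempotents_def ZM_maximal_idempotent_iff
proof (intro ballI impI)
  fix e assume "e \<in> idempotents (ZM C)" "e \<noteq> \<zero>\<^bsub>ZM C\<^esub>"
  then have "\<exists>!v. v \<in> Obj C \<and> idem_le (ZM C) e (tau C v)"
    by (intro idempotent_below_tau_object) simp_all
  then show "\<exists>!m. (\<exists>v \<in> Obj C. m = tau C v) \<and> idem_le (ZM C) e m"
    by blast
qed

lemma ZM_generated_by_paths: "generated_by_paths (ZM C)"
proof -
  let ?G = "generated_inverse_subsemigroup (ZM C) (paths (ZM C) \<union> {\<zero>\<^bsub>ZM C\<^esub>})"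
  have comp: "f \<circ>\<^sub>m g \<in> ?G" if "f \<in> ?G" "g \<in> ?G" for f g
    using generated_inverse_subsemigroup.mult[OF that] by simp
  have tau: "tau C \<alpha> \<in> ?G" if "\<alpha> \<in> Mor C" for \<alpha>
    using that by (simp add: ZM_paths generated_inverse_subsemigroup.base)
  have inv: "partial_inverse (tau C \<alpha>) \<in> ?G" if "\<alpha> \<in> Mor C" for \<alpha>
    using generated_inverse_subsemigroup.star[OF tau[OF that]] that by (simp add: ZM_star tau_in_ZM)
  have "zigzag_map C \<zeta> \<in> ?G" if "zigzag C \<zeta>" for \<zeta>
    using that
  proof (induction rule: zigzag_induct)
    case (single \<alpha> \<beta>)
    then show ?case
      unfolding zigzag_map_single by (intro comp inv tau)
  next
    case (Cons \<alpha> \<beta> \<zeta>)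
    then show ?case
      by (simp only: zigzag_map.simps fst_conv snd_conv comp inv tau)
  qed
  moreover have "Map.empty \<in> ?G"
    by (simp add: generated_inverse_subsemigroup.base)
  moreover have "?G \<subseteq> carrier (ZM C)"
    by (rule ZM.generated_subset) (auto simp: path_carrier ZM_empty)
  ultimately show ?thesis
    by (auto simp: generated_by_paths_def ZM_carrier_iff)
qed

text \<open>Since \<open>\<tau>\<^sub>\<alpha>\<close> is a domain path of \<open>f\<close> exactly if \<open>\<alpha>\<close> lies in the domain of \<open>f\<close>, the domain paths
  determine the domain; evaluating \<open>f \<tau>\<^sub>\<alpha>\<close> at \<open>s(\<alpha>)\<close> recovers \<open>f \<alpha>\<close>.\<close>

lemma ZM_right_reductive: "right_reductive_on_domain_paths (ZM C)"
  unfolding right_reductive_on_domain_paths_def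
proof (intro ballI impI)
  fix f g
  assume f: "f \<in> carrier (ZM C)" and g: "g \<in> carrier (ZM C)"
    and dom: "domain_paths (ZM C) f = domain_paths (ZM C) g"
    and agree: "\<forall>x \<in> domain_paths (ZM C) f. f \<otimes>\<^bsub>ZM C\<^esub> x = g \<otimes>\<^bsub>ZM C\<^esub> x"
  have dom_Mor: "\<alpha> \<in> dom k \<Longrightarrow> \<alpha> \<in> Mor C" if "k \<in> carrier (ZM C)" for k \<alpha>
    using equivariantD(1)[OF ZM_equivariant[OF that]] by blast
  have dom_eq: "\<alpha> \<in> dom f \<longleftrightarrow> \<alpha> \<in> dom g" for \<alpha>
    using dom dom_Mor[OF f, of \<alpha>] dom_Mor[OF g, of \<alpha>]
      ZM_domain_path_iff[OF f, of \<alpha>] ZM_domain_path_iff[OF g, of \<alpha>] by metis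
  show "f = g"
  proof
    fix \<alpha>
    show "f \<alpha> = g \<alpha>"
    proof (cases "\<alpha> \<in> dom f")
      case True
      then have \<alpha>: "\<alpha> \<in> Mor C"
        using dom_Mor[OF f] by blast
      then have "tau C \<alpha> (src C \<alpha>) = Some \<alpha>"
        using src_Obj Obj_subset by (auto simp: tau_eq_Some rng_ident ident_right)
      moreover have "f \<circ>\<^sub>m tau C \<alpha> = g \<circ>\<^sub>m tau C \<alpha>"
        using agree ZM_domain_path_iff[OF f \<alpha>] True by simp
      ultimately show ?thesis
        by (metis map_comp_simps(2))
    next
      case False
      then show ?thesis
        using dom_eq by (metis domIff)
    qed
  qed
qed

end

theorem zigzag_conditions_necessary:
  assumes "inverse_semigroup_with_zero S" "left_cancellative_category C" "S \<simeq> ZM C"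
  shows "admits_unique_maximal_idempotents S \<and> generated_by_paths S \<and>
    right_reductive_on_domain_paths S"
proof -
  interpret left_cancellative_category C
    by fact
  obtain h where "bij_betw h (carrier S) (carrier (ZM C))"
    "\<forall>s \<in> carrier S. \<forall>t \<in> carrier S. h (s \<otimes>\<^bsub>S\<^esub> t) = h s \<otimes>\<^bsub>ZM C\<^esub> h t"
    using assms(3) unfolding isomorphic_def by blast
  then interpret inverse_semigroup_isomorphism S "ZM C" h
    using assms(1) ZM_inverse_semigroup
    by (intro inverse_semigroup_isomorphism.intro inverse_semigroup_isomorphism_axioms.intro) blast+
  show ?thesis
    using unique_maximal_idempotents_invariant[OF ZM_admits_unique_maximal_idempotents]
      generated_by_paths_invariant[OF ZM_generated_by_paths]
      right_reductive_invariant[OF ZM_right_reductive] by blast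
qed


section \<open>The category of paths\<close>

definition path_category :: "'a zero_semigroup \<Rightarrow> 'a category" where
  "path_category S =
    \<lparr>Mor = paths S,
     Obj = {e. maximal_idempotent S e},
     src = (\<lambda>x. star S x \<otimes>\<^bsub>S\<^esub> x),
     rng = (\<lambda>x. THE m. maximal_idempotent S m \<and> idem_le S (x \<otimes>\<^bsub>S\<^esub> star S x) m),
     cat_comp = mult S\<rparr>"

lemma path_category_simps [simp]:
  "Mor (path_category S) = paths S"
  "Obj (path_category S) = {e. maximal_idempotent S e}"
  "src (path_category S) x = star S x \<otimes>\<^bsub>S\<^esub> x"
  "cat_comp (path_category S) = mult S"
  by (simp_all add: path_category_def)

context inverse_semigroup_with_zero
begin

lemma maximal_idempotentD:
  assumes "maximal_idempotent S e"
  shows "e \<in> idempotents S" "e \<in> carrier S" "e \<otimes> e = e" "e\<^sup>\<star> = e"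
  using assms star_idempotent by (auto simp: maximal_idempotent_def)

lemma maximal_idempotent_path: "maximal_idempotent S e \<Longrightarrow> e \<in> paths S"
  using maximal_idempotentD by (simp add: paths_def)

lemma path_nonzero: "x \<in> paths S \<Longrightarrow> x \<noteq> \<zero>"
  by (auto simp: paths_def maximal_idempotent_def)

lemma mult_path:
  assumes [simp]: "s \<in> carrier S" and x: "x \<in> paths S" and fixed: "s\<^sup>\<star> \<otimes> (s \<otimes> x) = x"
  shows "s \<otimes> x \<in> paths S" "(s \<otimes> x)\<^sup>\<star> \<otimes> (s \<otimes> x) = x\<^sup>\<star> \<otimes> x"
proof -
  note [simp] = path_carrier[OF x]
  show *: "(s \<otimes> x)\<^sup>\<star> \<otimes> (s \<otimes> x) = x\<^sup>\<star> \<otimes> x"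
    by (simp add: star_mult mult_assoc fixed)
  show "s \<otimes> x \<in> paths S"
    using x * by (simp add: paths_def)
qed

lemma path_source: "x \<in> paths S \<Longrightarrow> maximal_idempotent S (x\<^sup>\<star> \<otimes> x)"
  by (simp add: paths_def)

declare path_carrier [simp]

end

locale unique_maximal_semigroup = inverse_semigroup_with_zero +
  assumes unique_maximal: "admits_unique_maximal_idempotents S"
begin

abbreviation paths_cat ("\<C>")
  where "\<C> \<equiv> path_category S"

lemma ex1_maximal_above_range:
  assumes x: "x \<in> paths S"
  shows "\<exists>!m. maximal_idempotent S m \<and> idem_le S (x \<otimes> x\<^sup>\<star>) m"
proof -
  note [simp] = path_carrier[OF x]
  have "x \<otimes> x\<^sup>\<star> \<noteq> \<zero>"
  proof
    assume "x \<otimes> x\<^sup>\<star> = \<zero>"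
    then have "x \<otimes> x\<^sup>\<star> \<otimes> x = \<zero>"
      by simp
    then show False
      using path_nonzero[OF x] by (simp add: mult_assoc)
  qed
  then show ?thesis
    using unique_maximal mult_star_idempotent[of x]
    by (simp add: admits_unique_maximal_idempotents_def)
qed

lemma maximal_rng: "x \<in> paths S \<Longrightarrow> maximal_idempotent S (rng \<C> x)"
  using theI'[OF ex1_maximal_above_range] by (simp add: path_category_def)

lemma rng_eq_iff:
  assumes x: "x \<in> paths S" and m: "maximal_idempotent S m"
  shows "rng \<C> x = m \<longleftrightarrow> m \<otimes> x = x"
proof -
  have "rng \<C> x = m \<longleftrightarrow> idem_le S (x \<otimes> x\<^sup>\<star>) m"
    using theI'[OF ex1_maximal_above_range[OF x]] ex1_maximal_above_range[OF x] m
    by (auto simp: path_category_def)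
  then show ?thesis
    using range_le_iff[OF path_carrier[OF x] maximal_idempotentD(1)[OF m]] by simp
qed

lemma rng_mult: "x \<in> paths S \<Longrightarrow> rng \<C> x \<otimes> x = x"
  using rng_eq_iff[OF _ maximal_rng] by blast

text \<open>The source idempotent \<open>x\<^sup>\<star> \<otimes> x\<close> of a path is maximal, so it is the range of \<open>y\<close> as soon as it lies
  above \<open>y \<otimes> y\<^sup>\<star>\<close>, that is, as soon as it fixes \<open>y\<close>.\<close>

lemma composable_iff:
  assumes x: "x \<in> paths S" and y: "y \<in> paths S"
  shows "src \<C> x = rng \<C> y \<longleftrightarrow> x\<^sup>\<star> \<otimes> (x \<otimes> y) = y"
proof -
  have "maximal_idempotent S (x\<^sup>\<star> \<otimes> x)"
    using x by (simp add: path_source)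
  from rng_eq_iff[OF y this] have "rng \<C> y = x\<^sup>\<star> \<otimes> x \<longleftrightarrow> x\<^sup>\<star> \<otimes> (x \<otimes> y) = y"
    using x y by (simp add: mult_assoc)
  then show ?thesis
    by (metis path_category_simps(3))
qed

text \<open>If \<open>x\<close> and \<open>y\<close> are composable, then \<open>x\<^sup>\<star> \<otimes> x\<close> fixes \<open>y\<close>. Hence \<open>x \<otimes> y\<close> has the same source
  idempotent as \<open>y\<close>, and multiplication by \<open>x\<^sup>\<star>\<close> undoes multiplication by \<open>x\<close>.\<close>

lemma left_cancellative_path_category: "left_cancellative_category \<C>"
proof
  show "Obj \<C> \<subseteq> Mor \<C>"
    by (auto intro: maximal_idempotent_path)
  fix x assume "x \<in> Mor \<C>"
  then have x: "x \<in> paths S"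
    by simp
  note [simp] = path_carrier[OF x]
  show "src \<C> x \<in> Obj \<C>"
    using x by (simp add: path_source)
  show "rng \<C> x \<in> Obj \<C>"
    using x maximal_rng by simp
  show "rng \<C> x \<cdot>\<^bsub>\<C>\<^esub> x = x"
    using x rng_mult by simp
  show "x \<cdot>\<^bsub>\<C>\<^esub> src \<C> x = x"
    by simp
  fix y assume "y \<in> Mor \<C>" and xy_comp: "src \<C> x = rng \<C> y"
  then have y: "y \<in> paths S"
    by simp
  have fixed: "x\<^sup>\<star> \<otimes> (x \<otimes> y) = y"
    using composable_iff[OF x y] xy_comp by blast
  note [simp] = path_carrier[OF y]
  have xy: "x \<otimes> y \<in> paths S"
    using mult_path x y fixed by simp
  then show "x \<cdot>\<^bsub>\<C>\<^esub> y \<in> Mor \<C>"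
    by simp
  show "src \<C> (x \<cdot>\<^bsub>\<C>\<^esub> y) = src \<C> y"
    using mult_path(2)[of x y] y fixed by simp
  have "rng \<C> x \<otimes> (x \<otimes> y) = x \<otimes> y"
    using rng_mult[OF x] maximal_idempotentD(2)[OF maximal_rng[OF x]] by (simp flip: mult_assoc)
  then show "rng \<C> (x \<cdot>\<^bsub>\<C>\<^esub> y) = rng \<C> x"
    using rng_eq_iff[OF xy maximal_rng[OF x]] by simp
  fix z assume "z \<in> Mor \<C>"
  then have z: "z \<in> paths S"
    by simp
  show "x \<cdot>\<^bsub>\<C>\<^esub> y \<cdot>\<^bsub>\<C>\<^esub> z = x \<cdot>\<^bsub>\<C>\<^esub> (y \<cdot>\<^bsub>\<C>\<^esub> z)"
    using path_carrier[OF z] by (simp add: mult_assoc)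
  assume xz_comp: "src \<C> x = rng \<C> z" and "x \<cdot>\<^bsub>\<C>\<^esub> y = x \<cdot>\<^bsub>\<C>\<^esub> z"
  then have "x \<otimes> y = x \<otimes> z"
    by simp
  moreover have "x\<^sup>\<star> \<otimes> (x \<otimes> z) = z"
    using composable_iff[OF x z] xz_comp by blast
  ultimately show "y = z"
    using fixed by simp
next
  fix v assume "v \<in> Obj \<C>"
  then have v: "maximal_idempotent S v"
    by simp
  then show "src \<C> v = v" "rng \<C> v = v"
    using maximal_idempotentD[OF v] rng_eq_iff[OF maximal_idempotent_path[OF v] v] by simp_all
qed

sublocale path_cat: left_cancellative_category \<C>
  by (rule left_cancellative_path_category)


section \<open>The action on paths\<close>

text \<open>The analogue of the Wagner-Preston representation in which an element acts by left
  multiplication only on those paths that its domain idempotent fixes.\<close>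

definition path_action :: "'a \<Rightarrow> ('a \<rightharpoonup> 'a)" where
  "path_action s = (\<lambda>x. if x \<in> domain_paths S s then Some (s \<otimes> x) else None)"

lemma path_action_eq_Some:
  "s \<in> carrier S \<Longrightarrow>
    path_action s x = Some y \<longleftrightarrow> x \<in> paths S \<and> s\<^sup>\<star> \<otimes> (s \<otimes> x) = x \<and> y = s \<otimes> x"
  by (auto simp: path_action_def domain_paths_iff)

lemma inj_path_action: "s \<in> carrier S \<Longrightarrow> inj_on (path_action s) (dom (path_action s))"
  unfolding inj_on_dom_iff path_action_eq_Some by metis

text \<open>The domains agree: \<open>(s \<otimes> t)\<^sup>\<star> \<otimes> (s \<otimes> t)\<close> fixes \<open>x\<close> if and only if \<open>t\<^sup>\<star> \<otimes> t\<close> fixes \<open>x\<close> and \<open>s\<^sup>\<star> \<otimes> s\<close> fixes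
  \<open>t \<otimes> x\<close>. This uses that \<open>t \<otimes> t\<^sup>\<star>\<close> and \<open>s\<^sup>\<star> \<otimes> s\<close> commute.\<close>

lemma path_action_mult:
  assumes [simp]: "s \<in> carrier S" "t \<in> carrier S"
  shows "path_action (s \<otimes> t) = path_action s \<circ>\<^sub>m path_action t"
proof -
  have "t\<^sup>\<star> \<otimes> (s\<^sup>\<star> \<otimes> (s \<otimes> (t \<otimes> x))) = x
      \<longleftrightarrow> t\<^sup>\<star> \<otimes> (t \<otimes> x) = x \<and> s\<^sup>\<star> \<otimes> (s \<otimes> (t \<otimes> x)) = t \<otimes> x" (is "?l = x \<longleftrightarrow> ?r")
    if [simp]: "x \<in> carrier S" for x
  proof
    assume l: "?l = x"
    have "t\<^sup>\<star> \<otimes> (t \<otimes> ?l) = ?l"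
      by simp
    moreover have "t \<otimes> ?l = s\<^sup>\<star> \<otimes> (s \<otimes> (t \<otimes> x))"
      using support_commutes[of s t "t \<otimes> x"] by simp
    ultimately show ?r
      unfolding l by simp
  qed simp
  then show ?thesis
    using mult_path(1)[of t]
    by (auto simp: map_eq_iff map_comp_Some_iff path_action_eq_Some star_mult mult_assoc)
qed

lemma path_action_star:
  assumes [simp]: "s \<in> carrier S"
  shows "path_action (s\<^sup>\<star>) = partial_inverse (path_action s)"
proof -
  have "path_action (s\<^sup>\<star>) y = Some x" if "path_action s x = Some y" "s \<in> carrier S" for s x y
    using that mult_path(1)[of s x] by (simp add: path_action_eq_Some)
  from this[of s] this[of "s\<^sup>\<star>"]
  have "path_action (s\<^sup>\<star>) y = Some x \<longleftrightarrow> path_action s x = Some y" for x y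
    unfolding star_star[OF assms] using assms star_closed by blast
  then show ?thesis
    by (simp add: map_eq_iff partial_inverse_eq_Some[OF inj_path_action])
qed

lemma path_action_zero: "path_action \<zero> = Map.empty"
  using path_nonzero[of \<zero>] by (auto simp: map_eq_iff path_action_eq_Some)

text \<open>Both maps multiply by \<open>x\<close> from the left, and the domain paths of \<open>x\<close> are the paths \<open>y\<close> for which
  the composite of \<open>x\<close> and \<open>y\<close> is defined.\<close>

lemma path_action_path:
  assumes "x \<in> paths S"
  shows "path_action x = tau \<C> x"
proof -
  have "rng \<C> y = src \<C> x \<longleftrightarrow> x\<^sup>\<star> \<otimes> (x \<otimes> y) = y" if "y \<in> paths S" for y
    using composable_iff[OF assms that] by metis
  then show ?thesis
    using assms unfolding map_eq_iff path_action_eq_Some[OF path_carrier[OF assms]]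
    by (simp only: path_cat.tau_eq_Some path_category_simps(1,4)) blast
qed

lemma path_action_in_ZM:
  assumes "generated_by_paths S" "s \<in> carrier S"
  shows "path_action s \<in> carrier (ZM \<C>)"
proof -
  let ?A = "paths S \<union> {\<zero>}"
  have sub: "generated_inverse_subsemigroup S ?A \<subseteq> carrier S"
    by (rule generated_subset) (auto simp: path_carrier)
  have "s \<in> generated_inverse_subsemigroup S ?A"
    using assms by (simp add: generated_by_paths_def)
  then show ?thesis
  proof induction
    case (base a)
    then show ?case
      by (auto simp: path_action_path path_action_zero path_cat.tau_in_ZM path_cat.ZM_empty)
  next
    case (mult a b)
    then have "a \<in> carrier S" "b \<in> carrier S"
      using sub by auto
    then show ?case
      using mult by (simp add: path_action_mult path_cat.ZM_mult_closed)
  next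
    case (star a)
    then have "a \<in> carrier S"
      using sub by auto
    then show ?case
      using star by (simp add: path_action_star path_cat.ZM_partial_inverse_closed)
  qed
qed

text \<open>The image of the action is closed under products and contains the maps
  \<open>\<tau>\<^sub>x\<^sup>-\<^sup>1 \<tau>\<^sub>y\<close>, out of which zigzag maps are composed.\<close>

lemma ZM_subset_path_action: "carrier (ZM \<C>) \<subseteq> path_action ` carrier S"
proof -
  have generator: "partial_inverse (tau \<C> x) \<circ>\<^sub>m tau \<C> y = path_action (x\<^sup>\<star> \<otimes> y)"
    if "x \<in> paths S" "y \<in> paths S" for x y
    using that by (simp add: path_action_mult path_action_star path_action_path)
  have "zigzag_map \<C> \<zeta> \<in> path_action ` carrier S" if "zigzag \<C> \<zeta>" for \<zeta>
    using that
  proof (induction rule: zigzag_induct)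
    case (single x y)
    then show ?case
      unfolding zigzag_map_single using generator by auto
  next
    case (Cons x y \<zeta>)
    then obtain s where s: "s \<in> carrier S" "zigzag_map \<C> \<zeta> = path_action s"
      by blast
    have xy: "x \<in> carrier S" "y \<in> carrier S"
      using Cons by auto
    have "zigzag_map \<C> ((x, y) # \<zeta>) = path_action (x\<^sup>\<star> \<otimes> y) \<circ>\<^sub>m path_action s"
      using Cons s generator by (simp flip: map_comp_assoc)
    also have "\<dots> = path_action (x\<^sup>\<star> \<otimes> y \<otimes> s)"
      using s xy by (simp add: path_action_mult)
    finally have eq: "zigzag_map \<C> ((x, y) # \<zeta>) = path_action (x\<^sup>\<star> \<otimes> y \<otimes> s)" .
    show ?case
      unfolding eq using s xy by (intro imageI mult_closed star_closed)
  qed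
  moreover have "Map.empty \<in> path_action ` carrier S"
    using imageI[OF zero_closed, of path_action] by (simp only: path_action_zero)
  ultimately show ?thesis
    unfolding subset_iff ZM_carrier_iff by blast
qed

lemma inj_on_path_action:
  assumes "right_reductive_on_domain_paths S"
  shows "inj_on path_action (carrier S)"
proof (rule inj_onI)
  fix s t
  assume s: "s \<in> carrier S" and t: "t \<in> carrier S" and eq: "path_action s = path_action t"
  have dom: "dom (path_action u) = domain_paths S u" for u
    by (auto simp: path_action_def split: if_splits)
  have "domain_paths S s = domain_paths S t"
    using dom eq by metis
  moreover have "s \<otimes> x = t \<otimes> x" if "x \<in> domain_paths S s" for x
    using fun_cong[OF eq, of x] that calculation by (simp add: path_action_def)
  ultimately show "s = t"
    using assms s t unfolding right_reductive_on_domain_paths_def by blast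
qed

theorem isomorphic_ZM_path_category:
  assumes "generated_by_paths S" "right_reductive_on_domain_paths S"
  shows "S \<simeq> ZM \<C>"
proof -
  have "path_action ` carrier S = carrier (ZM \<C>)"
    using path_action_in_ZM[OF assms(1)] ZM_subset_path_action by blast
  then have "bij_betw path_action (carrier S) (carrier (ZM \<C>))"
    using inj_on_path_action[OF assms(2)] by (simp add: bij_betw_def)
  then show ?thesis
    unfolding isomorphic_def using path_action_mult by (intro exI[of _ path_action]) simp
qed

end


section \<open>The characterization\<close>

theorem theorem5p11:
  fixes S :: "'a zero_semigroup"
  assumes "inverse_semigroup_with_zero S"
  shows "((\<exists>C :: 'a category. left_cancellative_category C \<and> S \<simeq> ZM C) \<longleftrightarrow>
      admits_unique_maximal_idempotents S \<and>
      generated_by_paths S \<and>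
      right_reductive_on_domain_paths S)
    \<and> ((\<exists>D :: 'b category. left_cancellative_category D \<and> S \<simeq> ZM D) \<longrightarrow>
      admits_unique_maximal_idempotents S \<and>
      generated_by_paths S \<and>
      right_reductive_on_domain_paths S)"
proof (intro conjI iffI impI)
  assume Z: "admits_unique_maximal_idempotents S \<and> generated_by_paths S \<and>
    right_reductive_on_domain_paths S"
  then interpret unique_maximal_semigroup S
    using assms by (simp add: unique_maximal_semigroup_def unique_maximal_semigroup_axioms_def)
  show "\<exists>C :: 'a category. left_cancellative_category C \<and> S \<simeq> ZM C"
    using Z left_cancellative_path_category isomorphic_ZM_path_category by blast
qed (use zigzag_conditions_necessary[OF assms] in blast)+

end
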